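(* Let $S\subseteq\mathbb{Z}[x]$ be finite with $0\in S$, and let $a\in\mathbb{Z}$. Then the function $M\mapsto M(a)$ is a bijection from the set of totally $S$-modular matrices (over $\mathbb{Z}[x]$) to the set of totally $S(a)$-modular matrices (over $\mathbb{Z}$) if and only if $a\in\mathbb{Z}\setminus I(S)$. Moreover, $I(S)$ is finite, so this function fails to be a bijection for at most finitely many values $a\in\mathbb{Z}$.
   Context: Let $R$ be a commutative ring with unity and $T\subseteq R$. A matrix $M\in R^{m\times n}$ ($m,n\ge1$ arbitrary) is totally $T$-modular if every $k\times k$ subdeterminant of $M$ lies in $T$, for every $1\le k\le\min\{m,n\}$. For $S\subseteq\mathbb{Z}[x]$ and $a\in\mathbb{Z}$, $S(a)=\{s(a):s\in S\}\subseteq\mathbb{Z}$, and for a matrix $M$ over $\mathbb{Z}[x]$, $M(a)$ is the matrix over $\mathbb{Z}$ obtained by evaluating each entry at $x=a$. For $l\ge 2$, a matrix $M\in\mathbb{Z}[x]^{l\times l}$ is a forbidden submatrix for $S$ if every $(l-1)\times(l-1)$ submatrix of $M$ is totally $S$-modular but $\det M\notin S$. $F(S)\subseteq\mathbb{Z}[x]$ denotes the set of all polynomials that arise as the determinant of some forbidden submatrix for $S$ (over all $l\ge2$). Define $I(S)=\{a\in\mathbb{Z}: s(a)=f(a)\text{ for some }s\in S\text{ and }f\in F(S)\}$. *)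

theory Defs
  imports
    "HOL-Computational_Algebra.Polynomial"
    "Jordan_Normal_Form.Determinant"
    "Jordan_Normal_Form.DL_Submatrix"
begin

definition totally_modular :: "'a::comm_ring_1 set \<Rightarrow> 'a mat \<Rightarrow> bool" where
  "totally_modular T M \<longleftrightarrow>
     (\<forall>k\<in>{1..min (dim_row M) (dim_col M)}.
        \<forall>I\<subseteq>{..<dim_row M}. \<forall>J\<subseteq>{..<dim_col M}.
          card I = k \<longrightarrow> card J = k \<longrightarrow> det (submatrix M I J) \<in> T)"

(* The matrix type also contains matrices without rows or without columns
   (and distinguishes them by their dimensions); these are excluded here. *)
definition totally_modular_matrices :: "'a::comm_ring_1 set \<Rightarrow> 'a mat set" where
  "totally_modular_matrices T =
     {M. dim_row M \<ge> 1 \<and> dim_col M \<ge> 1 \<and> totally_modular T M}"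

definition eval_set :: "int poly set \<Rightarrow> int \<Rightarrow> int set" where
  "eval_set S a = (\<lambda>s. poly s a) ` S"

definition eval_mat :: "int poly mat \<Rightarrow> int \<Rightarrow> int mat" where
  "eval_mat M a = map_mat (\<lambda>p. poly p a) M"

definition forbidden_submatrix :: "int poly set \<Rightarrow> nat \<Rightarrow> int poly mat \<Rightarrow> bool" where
  "forbidden_submatrix S l M \<longleftrightarrow>
     l \<ge> 2 \<and> M \<in> carrier_mat l l \<and>
     (\<forall>I\<subseteq>{..<l}. \<forall>J\<subseteq>{..<l}. card I = l - 1 \<longrightarrow> card J = l - 1 \<longrightarrow>
        totally_modular S (submatrix M I J)) \<and>
     det M \<notin> S"

definition forbidden_dets :: "int poly set \<Rightarrow> int poly set" where
  "forbidden_dets S = {f. \<exists>l M. forbidden_submatrix S l M \<and> f = det M}"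

definition exceptional_points :: "int poly set \<Rightarrow> int set" where
  "exceptional_points S = {a. \<exists>s\<in>S. \<exists>f\<in>forbidden_dets S. poly s a = poly f a}"

end

theory Submission
  imports Defs
begin

text \<open>If \<open>a\<close> is not exceptional, evaluation at \<open>a\<close> is injective on \<open>S\<close>, so a totally
  \<open>S(a)\<close>-modular matrix has a unique entrywise lift to \<open>S\<close>. A smallest minor of the lift lying
  outside \<open>S\<close> would be the determinant of a forbidden submatrix whose value at \<open>a\<close> is in \<open>S(a)\<close>.
  Conversely, a forbidden \<open>M\<close> with \<open>det M(a)\<close> in \<open>S(a)\<close> evaluates to a totally \<open>S(a)\<close>-modular
  matrix whose only lift with entries in \<open>S\<close> is \<open>M\<close> itself.
  There are finitely many exceptional points because, by the Desnanot--Jacobi identity, only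
  finitely many polynomials are determinants of forbidden submatrices.\<close>

section \<open>Submatrices\<close>

declare pick.simps [simp del]

text \<open>By counting, \<open>g\<close> maps onto \<open>I\<close>, so exactly \<open>n\<close>
  elements of \<open>I\<close> lie below \<open>g n\<close>; this count determines the value of
  \<open>pick I n\<close>.\<close>

lemma pick_unique:
  assumes "finite I" and mono: "strict_mono_on {..<card I} g"
    and sub: "g ` {..<card I} \<subseteq> I" and n: "n < card I"
  shows "pick I n = g n"
proof -
  have inj: "inj_on g {..<card I}"
    using mono by (rule strict_mono_on_imp_inj_on)
  have img: "g ` {..<card I} = I"
    by (rule card_subset_eq[OF \<open>finite I\<close> sub]) (simp add: card_image inj)
  have "{a \<in> I. a < g n} = g ` {..<n}"
  proof
    show "{a \<in> I. a < g n} \<subseteq> g ` {..<n}"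
    proof
      fix a assume a: "a \<in> {a \<in> I. a < g n}"
      then obtain m where m: "m < card I" "a = g m" using img by auto
      then have "m < n"
        using a n strict_mono_on_leD[OF mono, of n m] by (cases "n \<le> m") auto
      then show "a \<in> g ` {..<n}" using m by auto
    qed
    show "g ` {..<n} \<subseteq> {a \<in> I. a < g n}"
    proof (rule image_subsetI)
      fix m assume "m \<in> {..<n}"
      then show "g m \<in> {a \<in> I. a < g n}"
        using sub n strict_mono_onD[OF mono, of m n] by auto
    qed
  qed
  moreover have "card (g ` {..<n}) = n"
    using inj_on_subset[OF inj, of "{..<n}"] n by (subst card_image) auto
  moreover have "g n \<in> I" using sub n by auto
  ultimately show ?thesis using pick_card_in_set[of "g n" I] by simp
qed

lemma strict_mono_on_pick: "strict_mono_on {..<card I} (pick I)"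
  by (auto intro!: strict_mono_onI pick_mono)

lemma inj_on_pick: "inj_on (pick I) {..<card I}"
  by (rule strict_mono_on_imp_inj_on[OF strict_mono_on_pick])

lemma pick_image_lessThan_card:
  assumes "finite I" shows "pick I ` {..<card I} = I"
  by (rule card_subset_eq[OF assms])
    (auto intro: pick_in_set simp: card_image inj_on_pick)

text \<open>The composition of two increasing enumerations is again increasing, so
  \<open>pick_unique\<close> identifies it.\<close>

lemma pick_pick_image:
  assumes "finite I" and sub: "I' \<subseteq> {..<card I}" and n: "n < card I'"
  shows "pick (pick I ` I') n = pick I (pick I' n)"
proof -
  have fin: "finite I'" using sub finite_subset by blast
  have card: "card (pick I ` I') = card I'"
    by (rule card_image[OF inj_on_subset[OF inj_on_pick sub]])
  have lt: "pick I' m < card I" if "m < card I'" for m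
    using pick_in_set[of m I'] that sub by auto
  show ?thesis
    by (rule pick_unique[where g = "\<lambda>m. pick I (pick I' m)"])
      (use fin n in \<open>auto simp: card lt pick_in_set intro!: strict_mono_onI pick_mono\<close>)
qed

lemma pick_singleton: "pick {i} 0 = i"
  using pick_in_set[of 0 "{i}"] by simp

lemma pick_lessThan: "k < n \<Longrightarrow> pick {..<n} k = k"
  by (rule pick_unique[where g = "\<lambda>x. x"]) (auto intro!: strict_mono_onI)

lemma pick_lessThan_remove:
  assumes "i < n" "k < n - 1"
  shows "pick ({..<n} - {i}) k = insert_index i k"
  by (rule pick_unique) (use assms in \<open>auto simp: insert_index_def intro!: strict_mono_onI\<close>)

lemma Collect_lessThan_subset: "I \<subseteq> {..<n} \<Longrightarrow> {i. i < n \<and> i \<in> I} = I"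
  by auto

lemma submatrix_dims:
  "I \<subseteq> {..<dim_row A} \<Longrightarrow> dim_row (submatrix A I J) = card I"
  "J \<subseteq> {..<dim_col A} \<Longrightarrow> dim_col (submatrix A I J) = card J"
  by (simp_all add: dim_submatrix Collect_lessThan_subset)

lemma submatrix_nth:
  assumes "I \<subseteq> {..<dim_row A}" "J \<subseteq> {..<dim_col A}" "i < card I" "j < card J"
  shows "submatrix A I J $$ (i, j) = A $$ (pick I i, pick J j)"
  using assms by (intro submatrix_index) (simp_all add: Collect_lessThan_subset)

lemma pick_image_subset:
  assumes "I \<subseteq> K" "I' \<subseteq> {..<card I}"
  shows "pick I ` I' \<subseteq> K"
proof -
  have "pick I x \<in> I" if "x \<in> I'" for x
    using that assms(2) by (intro pick_in_set) auto
  then show ?thesis using assms(1) by auto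
qed

text \<open>Turns every minor of a submatrix into a minor of the original matrix.\<close>

lemma submatrix_submatrix:
  assumes I: "I \<subseteq> {..<dim_row A}" and J: "J \<subseteq> {..<dim_col A}"
    and I': "I' \<subseteq> {..<card I}" and J': "J' \<subseteq> {..<card J}"
  shows "submatrix (submatrix A I J) I' J' = submatrix A (pick I ` I') (pick J ` J')"
proof (rule eq_matI)
  note fin = finite_subset[OF I finite_lessThan] finite_subset[OF J finite_lessThan]
  note d = submatrix_dims(1)[OF I, of J] submatrix_dims(2)[OF J, of I]
  note c = card_image[OF inj_on_subset[OF inj_on_pick I']] card_image[OF inj_on_subset[OF inj_on_pick J']]
  note s = pick_image_subset[OF I I'] pick_image_subset[OF J J']
  fix i j
  assume "i < dim_row (submatrix A (pick I ` I') (pick J ` J'))"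
    "j < dim_col (submatrix A (pick I ` I') (pick J ` J'))"
  then have ij: "i < card I'" "j < card J'" by (simp_all add: submatrix_dims s c)
  have "pick I' i < card I" "pick J' j < card J"
    using pick_in_set[of i I'] pick_in_set[of j J'] ij I' J' by auto
  then show "submatrix (submatrix A I J) I' J' $$ (i, j) =
      submatrix A (pick I ` I') (pick J ` J') $$ (i, j)"
    using ij by (simp add: submatrix_nth d I J I' J' s c pick_pick_image fin)
qed (use assms in \<open>simp_all add: submatrix_dims pick_image_subset
      card_image[OF inj_on_subset[OF inj_on_pick]]\<close>)

text \<open>Converse passage to \<open>submatrix_submatrix\<close>: the smaller index sets are
  pulled back along the injective enumerations \<open>pick I0\<close> and
  \<open>pick J0\<close>.\<close>

lemma submatrix_mono_obtain:
  assumes I0: "I0 \<subseteq> {..<dim_row A}" and J0: "J0 \<subseteq> {..<dim_col A}"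
    and I: "I \<subseteq> I0" and J: "J \<subseteq> J0"
  obtains I' J' where "I' \<subseteq> {..<card I0}" "J' \<subseteq> {..<card J0}"
    "card I' = card I" "card J' = card J"
    "submatrix A I J = submatrix (submatrix A I0 J0) I' J'"
proof -
  have *: "\<exists>K'\<subseteq>{..<card K0}. K = pick K0 ` K' \<and> card K' = card K"
    if "finite K0" "K \<subseteq> K0" for K0 K
  proof -
    have "K \<subseteq> pick K0 ` {..<card K0}"
      using that by (simp add: pick_image_lessThan_card)
    then obtain K' where K': "K' \<subseteq> {..<card K0}" "K = pick K0 ` K'"
      by (rule subset_imageE)
    moreover have "card K = card K'"
      unfolding K'(2) by (rule card_image[OF inj_on_subset[OF inj_on_pick K'(1)]])
    ultimately show ?thesis by auto
  qed
  obtain I' where I': "I' \<subseteq> {..<card I0}" "I = pick I0 ` I'" "card I' = card I"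
    using *[OF finite_subset[OF I0 finite_lessThan] I] by blast
  obtain J' where J': "J' \<subseteq> {..<card J0}" "J = pick J0 ` J'" "card J' = card J"
    using *[OF finite_subset[OF J0 finite_lessThan] J] by blast
  have "submatrix A I J = submatrix (submatrix A I0 J0) I' J'"
    unfolding I'(2) J'(2) by (rule submatrix_submatrix[OF I0 J0 I'(1) J'(1), symmetric])
  then show ?thesis by (rule that[OF I'(1) J'(1) I'(3) J'(3)])
qed

lemma submatrix_full: "submatrix A {..<dim_row A} {..<dim_col A} = A"
  by (rule eq_matI) (auto simp: submatrix_dims submatrix_nth pick_lessThan)

text \<open>Links Laplace expansion, phrased with \<open>mat_delete\<close>, to total modularity,
  phrased with \<open>submatrix\<close>.\<close>

lemma mat_delete_eq_submatrix:
  assumes "A \<in> carrier_mat n m" "i < n" "j < m"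
  shows "mat_delete A i j = submatrix A ({..<n} - {i}) ({..<m} - {j})"
proof (rule eq_matI)
  have d: "{..<n} - {i} \<subseteq> {..<dim_row A}" "{..<m} - {j} \<subseteq> {..<dim_col A}"
    using assms by auto
  note [simp] = submatrix_dims(1)[OF d(1)] submatrix_dims(2)[OF d(2)]
  show "dim_row (mat_delete A i j) = dim_row (submatrix A ({..<n} - {i}) ({..<m} - {j}))"
    "dim_col (mat_delete A i j) = dim_col (submatrix A ({..<n} - {i}) ({..<m} - {j}))"
    using assms by simp_all
  fix r c
  assume "r < dim_row (submatrix A ({..<n} - {i}) ({..<m} - {j}))"
    "c < dim_col (submatrix A ({..<n} - {i}) ({..<m} - {j}))"
  then have "r < n - 1" "c < m - 1" using assms by simp_all
  then show "mat_delete A i j $$ (r, c) = submatrix A ({..<n} - {i}) ({..<m} - {j}) $$ (r, c)"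
    using assms
    by (subst submatrix_nth[OF d]) (auto simp: mat_delete_def pick_lessThan_remove insert_index_def)
qed

section \<open>A Desnanot--Jacobi identity\<close>

lemma det_single_entry_column:
  assumes M: "M \<in> carrier_mat n n" and "i < n" "j < n"
    and col: "\<And>r. r < n \<Longrightarrow> M $$ (r, j) = (if r = i then c else 0)"
  shows "det M = c * cofactor M i j"
proof -
  have "det M = (\<Sum>r<n. M $$ (r, j) * cofactor M r j)"
    by (rule laplace_expansion_column[OF M \<open>j < n\<close>])
  also have "\<dots> = (\<Sum>r<n. if r = i then c * cofactor M r j else 0)"
    by (rule sum.cong) (auto simp: col)
  also have "\<dots> = c * cofactor M i j" using \<open>i < n\<close> by simp
  finally show ?thesis .
qed

lemma det_2x2:
  assumes "A \<in> carrier_mat 2 2"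
  shows "det A = A $$ (0, 0) * A $$ (1, 1) - A $$ (0, 1) * A $$ (1, 0)"
proof -
  have "det (mat_delete A i 0) = mat_delete A i 0 $$ (0, 0)" if "i < 2" for i
    using mat_delete_carrier[OF assms] by (intro det_single) simp
  moreover have "(\<Sum>i<2. A $$ (i, 0) * cofactor A i 0) = det A"
    using laplace_expansion_column[OF assms, of 0] by simp
  ultimately show ?thesis
    using assms by (simp add: numeral_2_eq_2 cofactor_def mat_delete_def algebra_simps)
qed

text \<open>The matrix is block lower triangular with an identity block at the bottom right, so only
  the top left 2 by 2 block contributes.\<close>

lemma det_identity_first_two_columns_replaced:
  fixes u v :: "nat \<Rightarrow> 'a::idom"
  assumes "2 \<le> n"
  shows "det (mat n n (\<lambda>(r, c). if c = 0 then u r else if c = 1 then v r else if r = c then 1 else 0))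
    = u 0 * v 1 - v 0 * u 1" (is "det ?B = _")
proof -
  let ?A1 = "mat 2 2 (\<lambda>(r, c). if c = 0 then u r else v r)"
  let ?A3 = "mat (n - 2) 2 (\<lambda>(r, c). if c = 0 then u (r + 2) else v (r + 2))"
  have B: "?B = four_block_mat ?A1 (0\<^sub>m 2 (n - 2)) ?A3 (1\<^sub>m (n - 2))"
  proof (rule eq_matI)
    fix r c
    assume "r < dim_row (four_block_mat ?A1 (0\<^sub>m 2 (n - 2)) ?A3 (1\<^sub>m (n - 2)))"
      "c < dim_col (four_block_mat ?A1 (0\<^sub>m 2 (n - 2)) ?A3 (1\<^sub>m (n - 2)))"
    then have rc: "r < n" "c < n" using assms by simp_all
    show "?B $$ (r, c) = four_block_mat ?A1 (0\<^sub>m 2 (n - 2)) ?A3 (1\<^sub>m (n - 2)) $$ (r, c)"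
    proof (cases "r < 2")
      case True
      then show ?thesis using rc by auto
    next
      case False
      \<comment> \<open>The lower left block shifts its row index by 2, so
        \<open>u (r - 2 + 2)\<close> has to be recognised as \<open>u r\<close>.\<close>
      then have "r - 2 + 2 = r" by simp
      then show ?thesis using rc False by (auto simp del: add_2_eq_Suc')
    qed
  qed (use assms in auto)
  have "det ?B = det ?A1 * det (1\<^sub>m (n - 2) :: 'a mat)"
    unfolding B by (rule det_four_block_mat_upper_right_zero) auto
  then show ?thesis by (simp add: det_2x2[of ?A1])
qed

text \<open>Multiply \<open>A\<close> by the identity matrix with its first two columns replaced by columns
  \<open>i\<close> and \<open>insert_index i k\<close> of the adjugate: the product is \<open>A\<close> with its first two columns
  replaced by multiples \<open>det A\<close> of unit vectors. Comparing determinants gives the identity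
  times \<open>det A\<close>.\<close>

lemma desnanot_jacobi:
  fixes A :: "'a::idom mat"
  assumes A: "A \<in> carrier_mat n n" and n: "2 \<le> n" and i: "i < n" and k: "k < n - 1"
    and nz: "det A \<noteq> 0"
  shows "det A * cofactor (mat_delete A i 0) k 0 * (-1) ^ i =
    cofactor A i 0 * cofactor A (insert_index i k) 1 -
    cofactor A (insert_index i k) 0 * cofactor A i 1"
proof -
  define f where "f = det A"
  \<comment> \<open>Row \<open>i2\<close> of \<open>A\<close> is the one that becomes row
    \<open>k\<close> once row \<open>i\<close> is deleted.\<close>
  define i2 where "i2 = insert_index i k"
  have i2: "i2 < n" using i k by (auto simp: i2_def insert_index_def)
  define B where "B = mat n n (\<lambda>(r, c). if c = 0 then cofactor A i r
    else if c = 1 then cofactor A i2 r else if r = c then 1 else 0)"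
  define P where "P = A * B"
  have B: "B \<in> carrier_mat n n" by (simp add: B_def)
  have P: "P \<in> carrier_mat n n" using A B by (simp add: P_def)
  note adj = adj_mat[OF A]
  have col_adj: "(A * adj_mat A) $$ (r, c) = (if r = c then f else 0)" if "r < n" "c < n" for r c
    using that by (simp add: adj(2) f_def)
  have P0: "P $$ (r, 0) = (if r = i then f else 0)" if "r < n" for r
  proof -
    have "col B 0 = col (adj_mat A) i"
      using n i A by (intro eq_vecI) (auto simp: B_def adj_mat_def)
    then have "P $$ (r, 0) = (A * adj_mat A) $$ (r, i)"
      using that n i A B adj(1) by (simp add: P_def)
    then show ?thesis using col_adj that i by simp
  qed
  have P1: "P $$ (r, 1) = (if r = i2 then f else 0)" if "r < n" for r
  proof -
    have "col B 1 = col (adj_mat A) i2"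
      using n i2 A by (intro eq_vecI) (auto simp: B_def adj_mat_def)
    then have "P $$ (r, 1) = (A * adj_mat A) $$ (r, i2)"
      using that n i2 A B adj(1) by (simp add: P_def)
    then show ?thesis using col_adj that i2 by simp
  qed
  have P2: "P $$ (r, c) = A $$ (r, c)" if "r < n" "c < n" "2 \<le> c" for r c
  proof -
    have "col B c = unit_vec n c"
      using that by (intro eq_vecI) (auto simp: B_def unit_vec_def)
    then show ?thesis using that A B by (simp add: P_def)
  qed
  define Q where "Q = mat_delete P i 0"
  have Q: "Q \<in> carrier_mat (n - 1) (n - 1)" unfolding Q_def by (rule mat_delete_carrier[OF P])
  \<comment> \<open>The first column of \<open>Q\<close> is column 1 of \<open>P\<close> without row
    \<open>i\<close>, so its only nonzero entry is \<open>f\<close> in row \<open>k\<close>.\<close>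
  have "det Q = f * cofactor Q k 0"
  proof (rule det_single_entry_column[OF Q k])
    show "0 < n - 1" using n by simp
    fix r assume r: "r < n - 1"
    then have "Q $$ (r, 0) = P $$ (insert_index i r, insert_index 0 0)"
      using P n i by (simp add: Q_def mat_delete_index[symmetric] mat_delete_def insert_index_def)
    then show "Q $$ (r, 0) = (if r = k then f else 0)"
      using P1[of "insert_index i r"] r i
      by (auto simp: insert_index_def i2_def)
  qed
  \<comment> \<open>Both replaced columns are now deleted, so only entries of \<open>A\<close>
    remain.\<close>
  moreover have "mat_delete Q k 0 = mat_delete (mat_delete A i 0) k 0"
    using n i k A P by (intro eq_matI) (auto simp: Q_def mat_delete_def P2)
  ultimately have detQ: "det Q = f * cofactor (mat_delete A i 0) k 0"
    by (simp add: cofactor_def)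
  have "det P = f * cofactor P i 0"
    using n by (intro det_single_entry_column[OF P i]) (auto simp: P0)
  also have "\<dots> = f * ((-1) ^ i * det Q)" by (simp add: cofactor_def Q_def)
  finally have "det P = f * (f * cofactor (mat_delete A i 0) k 0 * (-1) ^ i)"
    by (simp add: detQ algebra_simps)
  moreover have "det P = f * det B" unfolding P_def f_def by (rule det_mult[OF A B])
  \<comment> \<open>The two expressions for \<open>det P\<close> share a factor \<open>f\<close>,
    which is nonzero and cancels in an integral domain.\<close>
  ultimately have "f * cofactor (mat_delete A i 0) k 0 * (-1) ^ i = det B"
    using nz by (simp add: f_def)
  also have "det B = cofactor A i 0 * cofactor A i2 1 - cofactor A i2 0 * cofactor A i 1"
    unfolding B_def by (rule det_identity_first_two_columns_replaced[OF n])
  finally show ?thesis by (simp add: f_def i2_def)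
qed

text \<open>If all cofactors of column \<open>j\<close> were zero, Laplace expansion along it would
  give determinant zero.\<close>

lemma cofactor_nonzero_obtain:
  assumes "A \<in> carrier_mat n n" "j < n" "det A \<noteq> 0"
  obtains i where "i < n" "cofactor A i j \<noteq> 0"
proof -
  have "(\<Sum>i<n. A $$ (i, j) * cofactor A i j) \<noteq> 0"
    using assms laplace_expansion_column by metis
  then show ?thesis using that by (metis (no_types, lifting) lessThan_iff mult_zero_right sum.neutral)
qed

section \<open>Totally modular matrices\<close>

lemma totally_modularD:
  assumes "totally_modular T M" "I \<subseteq> {..<dim_row M}" "J \<subseteq> {..<dim_col M}"
    "card I = card J" "1 \<le> card I"
  shows "det (submatrix M I J) \<in> T"
proof -
  have "card I \<le> dim_row M" "card J \<le> dim_col M"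
    using assms card_mono[OF finite_lessThan assms(2)] card_mono[OF finite_lessThan assms(3)]
    by simp_all
  then show ?thesis using assms unfolding totally_modular_def by auto
qed

lemma totally_modularI:
  assumes "\<And>I J. I \<subseteq> {..<dim_row M} \<Longrightarrow> J \<subseteq> {..<dim_col M} \<Longrightarrow> card I = card J \<Longrightarrow>
    1 \<le> card I \<Longrightarrow> det (submatrix M I J) \<in> T"
  shows "totally_modular T M"
  using assms unfolding totally_modular_def by auto

lemma totally_modular_det:
  assumes "totally_modular T M" "M \<in> carrier_mat n n" "1 \<le> n"
  shows "det M \<in> T"
  using totally_modularD[OF assms(1), of "{..<n}" "{..<n}"] submatrix_full[of M] assms by auto

lemma totally_modular_entry:
  assumes "totally_modular T M" "i < dim_row M" "j < dim_col M"
  shows "M $$ (i, j) \<in> T"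
proof -
  have "submatrix M {i} {j} \<in> carrier_mat 1 1"
    using assms by (intro carrier_matI) (simp_all add: submatrix_dims)
  moreover have "submatrix M {i} {j} $$ (0, 0) = M $$ (i, j)"
    using assms by (subst submatrix_nth) (simp_all add: pick_singleton)
  ultimately show ?thesis
    using totally_modularD[OF assms(1), of "{i}" "{j}"] assms by (simp add: det_single)
qed

lemma totally_modular_1x1_iff:
  assumes "M \<in> carrier_mat 1 1"
  shows "totally_modular T M \<longleftrightarrow> M $$ (0, 0) \<in> T"
proof
  assume "totally_modular T M"
  then show "M $$ (0, 0) \<in> T" using assms by (auto intro: totally_modular_entry)
next
  assume *: "M $$ (0, 0) \<in> T"
  show "totally_modular T M"
  proof (rule totally_modularI)
    fix I J assume "I \<subseteq> {..<dim_row M}" "J \<subseteq> {..<dim_col M}" "card I = card J" "1 \<le> card I"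
    then have "I = {..<dim_row M}" "J = {..<dim_col M}"
      using assms by (auto simp: subset_singleton_iff lessThan_Suc)
    then show "det (submatrix M I J) \<in> T"
      using * assms by (simp only: submatrix_full det_single)
  qed
qed

lemma totally_modular_submatrix:
  assumes "totally_modular T M" "I \<subseteq> {..<dim_row M}" "J \<subseteq> {..<dim_col M}"
  shows "totally_modular T (submatrix M I J)"
proof (rule totally_modularI)
  fix I' J' assume IJ': "I' \<subseteq> {..<dim_row (submatrix M I J)}" "J' \<subseteq> {..<dim_col (submatrix M I J)}"
    "card I' = card J'" "1 \<le> card I'"
  then have sub: "I' \<subseteq> {..<card I}" "J' \<subseteq> {..<card J}"
    using assms by (simp_all add: submatrix_dims)
  have "det (submatrix M (pick I ` I') (pick J ` J')) \<in> T"
    using IJ'(3,4) sub assms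
    by (intro totally_modularD[OF assms(1)])
      (simp_all add: pick_image_subset card_image[OF inj_on_subset[OF inj_on_pick]])
  then show "det (submatrix (submatrix M I J) I' J') \<in> T"
    using assms sub by (simp add: submatrix_submatrix)
qed

lemma totally_modular_mat_delete:
  assumes "totally_modular T M" "M \<in> carrier_mat n m" "i < n" "j < m"
  shows "totally_modular T (mat_delete M i j)"
  unfolding mat_delete_eq_submatrix[OF assms(2-4)]
  by (rule totally_modular_submatrix[OF assms(1)]) (use assms(2) in auto)

section \<open>Evaluation\<close>

interpretation poly_at: comm_ring_hom "\<lambda>p. poly p a" for a :: "'a::comm_ring_1"
  by unfold_locales auto

lemma dim_eval_mat [simp]:
  "dim_row (eval_mat M a) = dim_row M" "dim_col (eval_mat M a) = dim_col M"
  by (simp_all add: eval_mat_def)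

lemma eval_mat_nth [simp]:
  "i < dim_row M \<Longrightarrow> j < dim_col M \<Longrightarrow> eval_mat M a $$ (i, j) = poly (M $$ (i, j)) a"
  by (simp add: eval_mat_def)

lemma det_eval_mat: "det (eval_mat M a) = poly (det M) a"
  unfolding eval_mat_def by (rule poly_at.hom_det)

lemma submatrix_eval_mat:
  assumes "I \<subseteq> {..<dim_row M}" "J \<subseteq> {..<dim_col M}"
  shows "submatrix (eval_mat M a) I J = eval_mat (submatrix M I J) a"
proof (rule eq_matI)
  fix i j assume "i < dim_row (eval_mat (submatrix M I J) a)" "j < dim_col (eval_mat (submatrix M I J) a)"
  then have ij: "i < card I" "j < card J" using assms by (simp_all add: submatrix_dims)
  then have "pick I i \<in> I" "pick J j \<in> J" by (auto intro: pick_in_set)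
  then have "pick I i < dim_row M" "pick J j < dim_col M" using assms by auto
  then show "submatrix (eval_mat M a) I J $$ (i, j) = eval_mat (submatrix M I J) a $$ (i, j)"
    using ij assms by (simp add: submatrix_nth submatrix_dims)
qed (use assms in \<open>simp_all add: submatrix_dims\<close>)

text \<open>Evaluation is a ring homomorphism and hence commutes with minors. So the map of the
  theorem is well defined for every \<open>a\<close>.\<close>

lemma eval_mat_totally_modular_matrices:
  assumes "M \<in> totally_modular_matrices S"
  shows "eval_mat M a \<in> totally_modular_matrices (eval_set S a)"
proof -
  have tm: "totally_modular S M" and dims: "dim_row M \<ge> 1" "dim_col M \<ge> 1"
    using assms by (simp_all add: totally_modular_matrices_def)
  have "totally_modular (eval_set S a) (eval_mat M a)"
    by (rule totally_modularI)
      (use totally_modularD[OF tm] in \<open>simp add: submatrix_eval_mat det_eval_mat eval_set_def\<close>)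
  then show ?thesis using dims by (simp add: totally_modular_matrices_def)
qed

section \<open>Forbidden submatrices\<close>

lemma forbidden_submatrix_carrier: "forbidden_submatrix S l M \<Longrightarrow> M \<in> carrier_mat l l"
  by (simp add: forbidden_submatrix_def)

lemma forbidden_detsI: "forbidden_submatrix S l M \<Longrightarrow> det M \<in> forbidden_dets S"
  unfolding forbidden_dets_def by blast

lemma forbidden_submatrix_mat_delete:
  assumes "forbidden_submatrix S l M" "i < l" "j < l"
  shows "totally_modular S (mat_delete M i j)"
  using assms by (simp add: forbidden_submatrix_def mat_delete_eq_submatrix[of M l l])

lemma exists_superset_card:
  fixes l :: nat
  assumes "I \<subseteq> {..<l}" "card I < l"
  obtains I0 where "I \<subseteq> I0" "I0 \<subseteq> {..<l}" "card I0 = l - 1"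
proof -
  have "I \<noteq> {..<l}" using assms by auto
  then obtain i where "i < l" "i \<notin> I" using assms by auto
  then show ?thesis using assms by (intro that[of "{..<l} - {i}"]) auto
qed

text \<open>Both index sets miss some index, so the minor lies within a submatrix of size
  \<open>l - 1\<close>, which is totally modular because \<open>M\<close> is forbidden.\<close>

lemma forbidden_submatrix_minor:
  assumes F: "forbidden_submatrix S l M" and I: "I \<subseteq> {..<l}" and J: "J \<subseteq> {..<l}"
    and c: "card I = card J" "1 \<le> card I" "card I < l"
  shows "det (submatrix M I J) \<in> S"
proof -
  obtain I0 where I0: "I \<subseteq> I0" "I0 \<subseteq> {..<l}" "card I0 = l - 1"
    using exists_superset_card I c by blast
  obtain J0 where J0: "J \<subseteq> J0" "J0 \<subseteq> {..<l}" "card J0 = l - 1"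
    using exists_superset_card J c by metis
  have M: "dim_row M = l" "dim_col M = l" using forbidden_submatrix_carrier[OF F] by auto
  obtain I' J' where IJ': "I' \<subseteq> {..<card I0}" "J' \<subseteq> {..<card J0}"
    "card I' = card I" "card J' = card J"
    "submatrix M I J = submatrix (submatrix M I0 J0) I' J'"
    using submatrix_mono_obtain[of I0 M J0 I J] I0 J0 M by metis
  have "totally_modular S (submatrix M I0 J0)"
    using F I0 J0 by (simp add: forbidden_submatrix_def)
  from totally_modularD[OF this, of I' J'] show ?thesis
    using IJ' c I0 J0 M by (simp add: submatrix_dims)
qed

text \<open>As \<open>l\<close> is at least 2, an entry is a proper minor.\<close>

lemma forbidden_submatrix_entry:
  assumes F: "forbidden_submatrix S l M" and "i < l" "j < l"
  shows "M $$ (i, j) \<in> S"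
proof -
  have M: "M \<in> carrier_mat l l" "2 \<le> l" using F by (simp_all add: forbidden_submatrix_def)
  have "submatrix M {i} {j} \<in> carrier_mat 1 1"
    using assms M by (intro carrier_matI) (simp_all add: submatrix_dims)
  moreover have "submatrix M {i} {j} $$ (0, 0) = M $$ (i, j)"
    using assms M by (subst submatrix_nth) (simp_all add: pick_singleton)
  ultimately show ?thesis
    using forbidden_submatrix_minor[OF F, of "{i}" "{j}"] assms M by (simp add: det_single)
qed

text \<open>In size 2 the proper minors are just the entries.\<close>

lemma forbidden_submatrix_2:
  assumes M: "M \<in> carrier_mat 2 2" and "\<And>i j. i < 2 \<Longrightarrow> j < 2 \<Longrightarrow> M $$ (i, j) \<in> S" "det M \<notin> S"
  shows "forbidden_submatrix S 2 M"
  unfolding forbidden_submatrix_def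
proof (intro conjI allI impI)
  fix I J :: "nat set"
  assume IJ: "I \<subseteq> {..<2}" "J \<subseteq> {..<2}" "card I = 2 - 1" "card J = 2 - 1"
  then have sub: "submatrix M I J \<in> carrier_mat 1 1"
    using M by (intro carrier_matI) (simp_all add: submatrix_dims)
  have "pick I 0 \<in> I" "pick J 0 \<in> J" using IJ by (auto intro: pick_in_set)
  then have "M $$ (pick I 0, pick J 0) \<in> S" using IJ assms(2) by blast
  then show "totally_modular S (submatrix M I J)"
    unfolding totally_modular_1x1_iff[OF sub] using IJ M by (subst submatrix_nth) auto
qed (use assms in auto)

text \<open>Take a minor outside \<open>S\<close> of least size. All proper minors of its submatrix
  are smaller minors of \<open>M\<close> and hence lie in \<open>S\<close>.\<close>

lemma not_totally_modular_obtain_forbidden: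
  assumes "\<not> totally_modular S M"
    and entry: "\<And>i j. i < dim_row M \<Longrightarrow> j < dim_col M \<Longrightarrow> M $$ (i, j) \<in> S"
  obtains I J where "I \<subseteq> {..<dim_row M}" "J \<subseteq> {..<dim_col M}" "card I = card J"
    "forbidden_submatrix S (card I) (submatrix M I J)"
proof -
  define Q where "Q k \<longleftrightarrow> (\<exists>I J. I \<subseteq> {..<dim_row M} \<and> J \<subseteq> {..<dim_col M} \<and> card I = k \<and>
    card J = k \<and> 1 \<le> k \<and> det (submatrix M I J) \<notin> S)" for k
  have "\<exists>k. Q k" using assms(1) unfolding Q_def totally_modular_def by fastforce
  then obtain l where l: "Q l" and least: "\<And>k. k < l \<Longrightarrow> \<not> Q k"
    using exists_least_iff[of Q] by blast
  obtain I J where I: "I \<subseteq> {..<dim_row M}" and J: "J \<subseteq> {..<dim_col M}"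
    and c: "card I = l" "card J = l" "1 \<le> l" and ns: "det (submatrix M I J) \<notin> S"
    using l unfolding Q_def by blast
  have carr: "submatrix M I J \<in> carrier_mat l l"
    using I J c by (intro carrier_matI) (simp_all add: submatrix_dims)
  \<comment> \<open>Forbidden submatrices have size at least 2; a bad minor of size 1 would be an
    entry outside \<open>S\<close>.\<close>
  have "l \<noteq> 1"
  proof
    assume "l = 1"
    then have "det (submatrix M I J) = M $$ (pick I 0, pick J 0)"
      using carr I J c by (simp add: det_single submatrix_nth)
    moreover have "pick I 0 \<in> I" "pick J 0 \<in> J" using c \<open>l = 1\<close> by (auto intro: pick_in_set)
    ultimately show False using entry ns I J by auto
  qed
  then have "2 \<le> l" using c by simp
  moreover have "totally_modular S (submatrix (submatrix M I J) I1 J1)"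
    if IJ1: "I1 \<subseteq> {..<l}" "J1 \<subseteq> {..<l}" "card I1 = l - 1" "card J1 = l - 1" for I1 J1
  proof (rule totally_modularI)
    let ?N = "submatrix M (pick I ` I1) (pick J ` J1)"
    have N: "submatrix (submatrix M I J) I1 J1 = ?N"
      using IJ1 I J c by (simp add: submatrix_submatrix)
    have s: "pick I ` I1 \<subseteq> {..<dim_row M}" "pick J ` J1 \<subseteq> {..<dim_col M}"
      using IJ1 I J c by (simp_all add: pick_image_subset)
    have card1: "card (pick I ` I1) = l - 1" "card (pick J ` J1) = l - 1"
      using IJ1 c by (simp_all add: card_image[OF inj_on_subset[OF inj_on_pick]])
    fix I' J'
    assume "I' \<subseteq> {..<dim_row (submatrix (submatrix M I J) I1 J1)}"
      "J' \<subseteq> {..<dim_col (submatrix (submatrix M I J) I1 J1)}"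
      and c': "card I' = card J'" "1 \<le> card I'"
    then have s': "I' \<subseteq> {..<card (pick I ` I1)}" "J' \<subseteq> {..<card (pick J ` J1)}"
      unfolding N using s by (simp_all add: submatrix_dims)
    have "card I' < l" using card_mono[OF finite_lessThan s'(1)] card1 \<open>2 \<le> l\<close> by simp
    then have "\<not> Q (card I')" by (rule least)
    moreover have "card (pick (pick I ` I1) ` I') = card I'" "card (pick (pick J ` J1) ` J') = card I'"
      using s' c' by (simp_all add: card_image[OF inj_on_subset[OF inj_on_pick]])
    ultimately show "det (submatrix (submatrix (submatrix M I J) I1 J1) I' J') \<in> S"
      unfolding N submatrix_submatrix[OF s s'] Q_def
      using pick_image_subset[OF s(1) s'(1)] pick_image_subset[OF s(2) s'(2)] c'(2) by blast
  qed
  ultimately have "forbidden_submatrix S l (submatrix M I J)"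
    using carr ns unfolding forbidden_submatrix_def by blast
  then show ?thesis using that I J c by metis
qed

section \<open>Finiteness of the forbidden determinants and of the exceptional points\<close>

lemma finite_mult_solutions:
  fixes m :: "'a::idom"
  assumes "m \<noteq> 0"
  shows "finite {f. f * m = c}"
proof (cases "\<exists>g. g * m = c")
  case True
  then obtain g where "g * m = c" by blast
  then have "{f. f * m = c} \<subseteq> {g}" using assms by auto
  then show ?thesis by (rule finite_subset) simp
qed simp

text \<open>Accounts for the sign by which a cofactor differs from a minor.\<close>

lemma minus_one_power_mult_in:
  fixes x :: "'a::ring_1"
  assumes "x \<in> S"
  shows "(-1) ^ k * x \<in> S \<union> uminus ` S"
  using assms by (cases "even k") auto

text \<open>By the Desnanot--Jacobi identity, the determinant of a forbidden submatrix is a quotient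
  built from elements of \<open>\<plusminus>S\<close> and a nonzero denominator in \<open>\<plusminus>(S \<union> {1})\<close>; the \<open>1\<close> is the empty
  minor arising for \<open>l = 2\<close>.\<close>

lemma finite_forbidden_dets:
  assumes "finite S" "0 \<in> S"
  shows "finite (forbidden_dets S)"
proof -
  define T where "T = S \<union> uminus ` S"
  define U where "U = (insert 1 S \<union> uminus ` insert 1 S) - {0}"
  define C where "C = (\<lambda>(a, b, c, d). a * b - c * d) ` (T \<times> T \<times> T \<times> T)"
  have "forbidden_dets S \<subseteq> (\<Union>m\<in>U. \<Union>c\<in>C. {f. f * m = c})"
  proof
    fix f assume "f \<in> forbidden_dets S"
    then obtain l M where F: "forbidden_submatrix S l M" and f: "f = det M"
      unfolding forbidden_dets_def by blast
    have M: "M \<in> carrier_mat l l" and l: "2 \<le> l" and nz: "det M \<noteq> 0"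
      using F assms(2) by (auto simp: forbidden_submatrix_def)
    have cof: "cofactor M i j \<in> T" if "i < l" "j < l" for i j
      unfolding cofactor_def T_def
      by (rule minus_one_power_mult_in,
          rule totally_modular_det[OF forbidden_submatrix_mat_delete[OF F that] mat_delete_carrier[OF M]])
        (use l in simp)
    \<comment> \<open>Rows \<open>i\<close> and then \<open>k\<close> are chosen by two successive
      Laplace expansions so that the denominator in the Desnanot--Jacobi identity is
      nonzero.\<close>
    obtain i where i: "i < l" "cofactor M i 0 \<noteq> 0"
      using cofactor_nonzero_obtain[OF M _ nz, of 0] l by auto
    let ?N = "mat_delete M i 0"
    have N: "?N \<in> carrier_mat (l - 1) (l - 1)" by (rule mat_delete_carrier[OF M])
    have "det ?N \<noteq> 0" using i by (simp add: cofactor_def)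
    then obtain k where k: "k < l - 1" "cofactor ?N k 0 \<noteq> 0"
      using cofactor_nonzero_obtain[OF N, of 0] l by auto
    have "det (mat_delete ?N k 0) \<in> insert 1 S"
    proof (cases "l = 2")
      case True
      then show ?thesis using mat_delete_carrier[OF N, of k 0] by simp
    next
      case False
      have "totally_modular S ?N" using forbidden_submatrix_mat_delete[OF F] i l by simp
      then have "totally_modular S (mat_delete ?N k 0)"
        by (rule totally_modular_mat_delete[OF _ N k(1)]) (use k in simp)
      then have "det (mat_delete ?N k 0) \<in> S"
        by (rule totally_modular_det[OF _ mat_delete_carrier[OF N]]) (use l False in simp)
      then show ?thesis by simp
    qed
    \<comment> \<open>The sign \<open>(-1) ^ k\<close> of the cofactor and the factor
      \<open>(-1) ^ i\<close> of the identity merge into one.\<close>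
    from minus_one_power_mult_in[OF this, of "k + i"]
    have "cofactor ?N k 0 * (-1) ^ i \<in> U"
      using k by (simp add: U_def cofactor_def power_add mult.commute mult.left_commute)
    moreover have "f * (cofactor ?N k 0 * (-1) ^ i) \<in> C"
    proof -
      have "insert_index i k < l" using i k by (auto simp: insert_index_def)
      then have "(cofactor M i 0, cofactor M (insert_index i k) 1,
          cofactor M (insert_index i k) 0, cofactor M i 1) \<in> T \<times> T \<times> T \<times> T"
        using cof i l by auto
      from imageI[OF this, of "\<lambda>(a, b, c, d). a * b - c * d"] show ?thesis
        using desnanot_jacobi[OF M l i(1) k(1) nz] by (simp add: C_def f mult.assoc)
    qed
    ultimately show "f \<in> (\<Union>m\<in>U. \<Union>c\<in>C. {f. f * m = c})" by blast
  qed
  moreover have "finite (\<Union>m\<in>U. \<Union>c\<in>C. {f. f * m = c})"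
  proof (intro finite_UN_I)
    show "finite U" "finite C" using assms by (auto simp: U_def C_def T_def)
  qed (auto simp: U_def intro: finite_mult_solutions)
  ultimately show ?thesis by (rule finite_subset)
qed

text \<open>There are finitely many pairs of \<open>s\<close> in \<open>S\<close> and a forbidden
  determinant \<open>f\<close>. Since \<open>f\<close> is not in \<open>S\<close>, the polynomial
  \<open>s - f\<close> is nonzero and has finitely many roots.\<close>

lemma finite_exceptional_points:
  assumes "finite S" "0 \<in> S"
  shows "finite (exceptional_points S)"
proof -
  have "exceptional_points S \<subseteq> (\<Union>s\<in>S. \<Union>f\<in>forbidden_dets S. {a. poly (s - f) a = 0})"
    unfolding exceptional_points_def by auto
  moreover have "finite (\<Union>s\<in>S. \<Union>f\<in>forbidden_dets S. {a. poly (s - f) a = 0})"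
  proof (intro finite_UN_I assms finite_forbidden_dets poly_roots_finite)
    fix s f assume "s \<in> S" "f \<in> forbidden_dets S"
    then show "s - f \<noteq> 0" by (auto simp: forbidden_dets_def forbidden_submatrix_def)
  qed
  ultimately show ?thesis by (rule finite_subset)
qed

section \<open>Bijectivity of evaluation\<close>

text \<open>If \<open>s\<close> and \<open>s'\<close> agree at \<open>a\<close>, the matrix with rows \<open>(s, s)\<close> and \<open>(s', s)\<close> either is forbidden
  or shows that \<open>S\<close> contains a nonzero polynomial vanishing at \<open>a\<close>. In the latter case, for such a
  polynomial \<open>t\<close> of maximal degree, the matrix \<open>diag(t, t)\<close> is forbidden.\<close>

lemma inj_on_eval_nonexceptional:
  assumes "finite S" "0 \<in> S" and a: "a \<notin> exceptional_points S"
  shows "inj_on (\<lambda>s. poly s a) S"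
proof -
  \<comment> \<open>Otherwise this 2 by 2 determinant would be forbidden and agree at
    \<open>a\<close> with the element 0 of \<open>S\<close>.\<close>
  have two: "p * q - r * s \<in> S"
    if "p \<in> S" "q \<in> S" "r \<in> S" "s \<in> S" "poly (p * q - r * s) a = 0" for p q r s
  proof (rule ccontr)
    assume neg: "p * q - r * s \<notin> S"
    let ?M = "mat 2 2 (\<lambda>(i, j). if i = 0 then if j = 0 then p else r else if j = 0 then s else q)"
    have det: "det ?M = p * q - r * s" by (simp add: det_2x2[of ?M])
    have "forbidden_submatrix S 2 ?M"
      by (rule forbidden_submatrix_2) (use that neg det in auto)
    from forbidden_detsI[OF this] have "p * q - r * s \<in> forbidden_dets S"
      by (simp only: det)
    moreover have "poly 0 a = poly (p * q - r * s) a" using that(5) by simp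
    ultimately show False using a assms(2) unfolding exceptional_points_def by blast
  qed
  have no_root: "t = 0" if "t \<in> S" "poly t a = 0" for t
  proof (rule ccontr)
    assume "t \<noteq> 0"
    let ?Z = "{t \<in> S. t \<noteq> 0 \<and> poly t a = 0}"
    have fin: "finite ?Z" and "?Z \<noteq> {}" using assms(1) that \<open>t \<noteq> 0\<close> by auto
    then obtain u where u: "u \<in> ?Z" "Max (degree ` ?Z) = degree u"
      by (rule obtains_MAX)
    have max: "degree v \<le> degree u" if "v \<in> ?Z" for v
      unfolding u(2)[symmetric] by (rule Max_ge) (use fin that in auto)
    \<comment> \<open>The square also vanishes at \<open>a\<close> but has twice the degree.
      Maximality makes \<open>u\<close> constant, and a constant with a root is zero.\<close>
    have "u * u \<in> S" using two[of u u 0 0] u assms(2) by simp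
    then have "degree (u * u) \<le> degree u" using u by (intro max) auto
    then have "degree u = 0" using u by (simp add: degree_mult_eq)
    then show False using u by (auto elim!: degree_eq_zeroE)
  qed
  show ?thesis
  proof (rule inj_onI, rule ccontr)
    \<comment> \<open>The determinant \<open>s * (s - s')\<close> vanishes at \<open>a\<close>,
      hence is zero. By symmetry \<open>s'\<close> is zero too, contradicting that the two
      differ.\<close>
    have zero: "s = 0" if "s \<in> S" "s' \<in> S" "poly s a = poly s' a" "s \<noteq> s'" for s s'
    proof -
      have "s * s - s * s' \<in> S" using two[of s s s s'] that by simp
      moreover have "poly (s * s - s * s') a = 0" using that by simp
      ultimately have "s * s - s * s' = 0" by (rule no_root)
      then have "s * (s - s') = 0" by (simp only: right_diff_distrib)
      then show ?thesis using that by simp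
    qed
    fix s s' assume "s \<in> S" "s' \<in> S" "poly s a = poly s' a" "s \<noteq> s'"
    then show False using zero[of s s'] zero[of s' s] by simp
  qed
qed

lemma bij_betw_eval_mat_nonexceptional:
  assumes "finite S" "0 \<in> S" and a: "a \<notin> exceptional_points S"
  shows "bij_betw (\<lambda>M. eval_mat M a)
    (totally_modular_matrices S) (totally_modular_matrices (eval_set S a))"
proof (rule bij_betw_imageI)
  note inj = inj_on_eval_nonexceptional[OF assms]
  show "inj_on (\<lambda>M. eval_mat M a) (totally_modular_matrices S)"
  proof (rule inj_onI)
    fix M N assume M: "M \<in> totally_modular_matrices S" and N: "N \<in> totally_modular_matrices S"
      and eq: "eval_mat M a = eval_mat N a"
    have d: "dim_row M = dim_row N" "dim_col M = dim_col N"
      using arg_cong[OF eq, of dim_row] arg_cong[OF eq, of dim_col] by simp_all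
    show "M = N"
    proof (rule eq_matI)
      fix i j assume ij: "i < dim_row N" "j < dim_col N"
      have "poly (M $$ (i, j)) a = poly (N $$ (i, j)) a"
        using arg_cong[OF eq, of "\<lambda>X. X $$ (i, j)"] ij d by simp
      then show "M $$ (i, j) = N $$ (i, j)"
        using M N ij d
        by (intro inj_onD[OF inj]) (auto simp: totally_modular_matrices_def intro: totally_modular_entry)
    qed (use d in auto)
  qed
  show "(\<lambda>M. eval_mat M a) ` totally_modular_matrices S = totally_modular_matrices (eval_set S a)"
  proof (intro equalityI subsetI)
    fix N assume "N \<in> totally_modular_matrices (eval_set S a)"
    then have N: "totally_modular (eval_set S a) N" "1 \<le> dim_row N" "1 \<le> dim_col N"
      by (simp_all add: totally_modular_matrices_def)
    \<comment> \<open>This inverse is applied only to entries of \<open>N\<close>, which are 1 by 1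
      minors and thus values at \<open>a\<close> of elements of \<open>S\<close>.\<close>
    let ?g = "inv_into S (\<lambda>s. poly s a)"
    define M where "M = map_mat ?g N"
    have Nentry: "N $$ (i, j) \<in> (\<lambda>s. poly s a) ` S" if "i < dim_row N" "j < dim_col N" for i j
      using totally_modular_entry[OF N(1) that] by (simp add: eval_set_def)
    have entry: "M $$ (i, j) \<in> S" if "i < dim_row M" "j < dim_col M" for i j
      using inv_into_into[OF Nentry] that by (simp add: M_def)
    have eval: "eval_mat M a = N"
      by (rule eq_matI) (auto simp: M_def f_inv_into_f[OF Nentry])
    have "totally_modular S M"
    proof (rule ccontr)
      assume "\<not> totally_modular S M"
      then obtain I J where IJ: "I \<subseteq> {..<dim_row M}" "J \<subseteq> {..<dim_col M}" "card I = card J"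
        and F: "forbidden_submatrix S (card I) (submatrix M I J)"
        using not_totally_modular_obtain_forbidden entry by metis
      have "2 \<le> card I" using F by (simp add: forbidden_submatrix_def)
      then have "det (submatrix N I J) \<in> eval_set S a"
        using IJ by (intro totally_modularD[OF N(1)]) (simp_all add: M_def)
      then have "poly (det (submatrix M I J)) a \<in> eval_set S a"
        using IJ by (simp add: eval[symmetric] submatrix_eval_mat det_eval_mat)
      then obtain s where "s \<in> S" "poly s a = poly (det (submatrix M I J)) a"
        by (auto simp: eval_set_def)
      moreover have "det (submatrix M I J) \<in> forbidden_dets S"
        by (rule forbidden_detsI[OF F])
      ultimately show False using a unfolding exceptional_points_def by blast
    qed
    then have "M \<in> totally_modular_matrices S"
      using N by (simp add: totally_modular_matrices_def M_def)
    then show "N \<in> (\<lambda>M. eval_mat M a) ` totally_modular_matrices S" using eval by blast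
  qed (auto intro: eval_mat_totally_modular_matrices)
qed

lemma not_bij_betw_eval_mat_exceptional:
  assumes a: "a \<in> exceptional_points S"
  shows "\<not> bij_betw (\<lambda>M. eval_mat M a)
    (totally_modular_matrices S) (totally_modular_matrices (eval_set S a))"
proof
  assume bij: "bij_betw (\<lambda>M. eval_mat M a)
    (totally_modular_matrices S) (totally_modular_matrices (eval_set S a))"
  \<comment> \<open>Injectivity on 1 by 1 matrices already makes evaluation at \<open>a\<close>
    injective on \<open>S\<close>.\<close>
  have inj: "s = s'" if "s \<in> S" "s' \<in> S" "poly s a = poly s' a" for s s'
  proof -
    let ?c = "\<lambda>s. mat 1 1 (\<lambda>_. s)"
    have "?c s \<in> totally_modular_matrices S" "?c s' \<in> totally_modular_matrices S"
      using that by (simp_all add: totally_modular_matrices_def totally_modular_1x1_iff)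
    moreover have "eval_mat (?c s) a = eval_mat (?c s') a"
      using that by (intro eq_matI) auto
    ultimately have "?c s = ?c s'" using bij by (auto simp: bij_betw_def dest: inj_onD)
    from arg_cong[OF this, of "\<lambda>X. X $$ (0, 0)"] show ?thesis by simp
  qed
  obtain s l M where s: "s \<in> S" and F: "forbidden_submatrix S l M"
    and eq: "poly s a = poly (det M) a"
    using a by (auto simp: exceptional_points_def forbidden_dets_def)
  have M: "M \<in> carrier_mat l l" "dim_row M = l" "dim_col M = l" "2 \<le> l" "det M \<notin> S"
    using F by (auto simp: forbidden_submatrix_def)
  have "totally_modular (eval_set S a) (eval_mat M a)"
  proof (rule totally_modularI)
    fix I J assume IJ: "I \<subseteq> {..<dim_row (eval_mat M a)}" "J \<subseteq> {..<dim_col (eval_mat M a)}"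
      "card I = card J" "1 \<le> card I"
    show "det (submatrix (eval_mat M a) I J) \<in> eval_set S a"
    proof (cases "card I < l")
      case True
      then show ?thesis
        using forbidden_submatrix_minor[OF F, of I J] IJ M
        by (simp add: submatrix_eval_mat det_eval_mat eval_set_def)
    next
      \<comment> \<open>Only the full minor is left; \<open>det M\<close> lies outside
        \<open>S\<close>, but its value at \<open>a\<close> is that of \<open>s\<close>.\<close>
      case False
      have "I = {..<l}" "J = {..<l}"
        using IJ M False card_seteq[of "{..<l}" I] card_seteq[of "{..<l}" J] by simp_all
      then have "submatrix (eval_mat M a) I J = eval_mat M a"
        using submatrix_full[of "eval_mat M a"] M by simp
      then show ?thesis
        using imageI[OF s, of "\<lambda>s. poly s a"] eq by (simp add: det_eval_mat eval_set_def)
    qed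
  qed
  then have "eval_mat M a \<in> totally_modular_matrices (eval_set S a)"
    using M by (simp add: totally_modular_matrices_def)
  then obtain N where N: "N \<in> totally_modular_matrices S" "eval_mat M a = eval_mat N a"
    using bij unfolding bij_betw_def by blast
  have tm: "totally_modular S N" using N by (simp add: totally_modular_matrices_def)
  have d: "dim_row N = l" "dim_col N = l"
    using arg_cong[OF N(2), of dim_row] arg_cong[OF N(2), of dim_col] M by simp_all
  \<comment> \<open>Both matrices have their entries in \<open>S\<close>, where evaluation at
    \<open>a\<close> is injective.\<close>
  have "M = N"
  proof (rule eq_matI)
    fix i j assume ij: "i < dim_row N" "j < dim_col N"
    then have "poly (M $$ (i, j)) a = poly (N $$ (i, j)) a"
      using arg_cong[OF N(2), of "\<lambda>X. X $$ (i, j)"] M d by simp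
    then show "M $$ (i, j) = N $$ (i, j)"
      using forbidden_submatrix_entry[OF F] totally_modular_entry[OF tm] ij d inj by simp
  qed (use M d in auto)
  moreover have "det N \<in> S" using totally_modular_det[OF tm, of l] d M by auto
  ultimately show False using M by simp
qed

theorem theorem3:
  fixes S :: "int poly set" and a :: int
  assumes "finite S" and "0 \<in> S"
  shows "(bij_betw (\<lambda>M. eval_mat M a)
            (totally_modular_matrices S) (totally_modular_matrices (eval_set S a))
          \<longleftrightarrow> a \<in> UNIV - exceptional_points S)
       \<and> finite (exceptional_points S)
       \<and> finite {b::int. \<not> bij_betw (\<lambda>M. eval_mat M b)
            (totally_modular_matrices S) (totally_modular_matrices (eval_set S b))}"
proof -
  \<comment> \<open>Proved for every point \<open>b\<close>, so that the set of failing points is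
    exactly \<open>exceptional_points S\<close>.\<close>
  have iff: "bij_betw (\<lambda>M. eval_mat M b)
      (totally_modular_matrices S) (totally_modular_matrices (eval_set S b))
    \<longleftrightarrow> b \<notin> exceptional_points S" for b
    using bij_betw_eval_mat_nonexceptional[OF assms] not_bij_betw_eval_mat_exceptional by blast
  then show ?thesis using finite_exceptional_points[OF assms] by simp
qed

end
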